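(* Let $V\cong\mathbb{F}_q^n$ be an $n$-dimensional vector space over the finite field $\mathbb{F}_q$, and let $L(V)$ be the lattice of subspaces of $V$ ordered by inclusion. (i) If $n=0$ or $n=1$, then $L(V)$ is isomorphic to the lattice induced by a covering, i.e. there are a finite set $U$ and a covering $\mathcal{C}$ of $U$ with $L(\mathcal{C})\cong L(V)$. (ii) Let $\mathcal{C}$ be a covering of a finite set $U$ with $|U|=m$, such that there are no two distinct elements $u,v\in U$ with $\mathcal{C}(\{u\})=\mathcal{C}(\{v\})$ and $|\mathcal{C}(\{u\})|=1$. Suppose that $L(\mathcal{C})$ is uniform and $|L^{(2)}(\mathcal{C})|<\binom{m}{2}$, and let $k:=|\mathcal{E}|$. If $n=2$, $m=q+1$, and $k=1$, then $L(\mathcal{C})\cong L(V)$.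
   Context: A covering of a finite set $U$ (possibly empty) is a collection $\mathcal{C}\subseteq 2^U$ of subsets of $U$ whose union is $U$. For $H\subseteq U$, $\mathcal{C}(H):=\{C\in\mathcal{C} : C\cap H\neq\emptyset\}$. The matroid $M(\mathcal{C})$ is the transversal matroid of $\mathcal{C}$ on the ground set $U$: its independent sets are the partial transversals of $\mathcal{C}$, i.e. the sets $I\subseteq U$ for which there is an injective map $\varphi:I\to\mathcal{C}$ with $e\in\varphi(e)$ for all $e\in I$. $L(\mathcal{C})$ is the lattice of closed sets (flats) of $M(\mathcal{C})$ ordered by inclusion, and $L^{(\ell)}(\mathcal{C})$ is the set of its elements of height $\ell$. A ranked lattice is uniform if any two elements of equal rank are covered by the same number of elements. For $x\in U$ with $|\mathcal{C}(\{x\})|=2$, $E(\{x\}):=\{y\in U : \mathcal{C}(\{y\})\subseteq\mathcal{C}(\{x\})\}$, and $\mathcal{E}:=\{E(\{x\}) : x\in U,\ |\mathcal{C}(\{x\})|=2\}$. *)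

theory Defs
  imports Complex_Main "HOL-Library.Cardinality"
begin

section \<open>Finite partially ordered sets, given by their carriers\<close>

text \<open>A lattice is a set \<open>L\<close> of elements of an ordered type, with the restricted order;
  lattice isomorphisms are exactly the order isomorphisms.\<close>

definition order_isomorphic :: "'a::order set \<Rightarrow> 'b::order set \<Rightarrow> bool" where
  "order_isomorphic L L' \<longleftrightarrow>
     (\<exists>f. bij_betw f L L' \<and> (\<forall>x\<in>L. \<forall>y\<in>L. x \<le> y \<longleftrightarrow> f x \<le> f y))"

definition covered_by :: "'a::order set \<Rightarrow> 'a \<Rightarrow> 'a \<Rightarrow> bool" where
  "covered_by L x y \<longleftrightarrow> x \<in> L \<and> y \<in> L \<and> x < y \<and> \<not> (\<exists>z\<in>L. x < z \<and> z < y)"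

text \<open>The height of \<open>x\<close> is the greatest length (number of elements minus one) of a chain
  of \<open>L\<close> below \<open>x\<close>; it is meant for finite \<open>L\<close> and \<open>x \<in> L\<close>.\<close>

definition height :: "'a::order set \<Rightarrow> 'a \<Rightarrow> nat" where
  "height L x = Max {card K - 1 |K. K \<noteq> {} \<and> K \<subseteq> {y \<in> L. y \<le> x} \<and>
     Complete_Partial_Order.chain (\<le>) K}"

text \<open>In a ranked lattice the rank of an element is its height. The definition is only applied
  to lattices of flats of matroids, which are ranked.\<close>

definition uniform_lattice :: "'a::order set \<Rightarrow> bool" where
  "uniform_lattice L \<longleftrightarrow>
     (\<forall>x\<in>L. \<forall>y\<in>L. height L x = height L y \<longrightarrow>
        card {z. covered_by L x z} = card {z. covered_by L y z})"

section \<open>Coverings and their transversal matroids\<close>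

definition covering :: "'u set \<Rightarrow> 'u set set \<Rightarrow> bool" where
  "covering U \<C> \<longleftrightarrow> finite U \<and> \<C> \<subseteq> Pow U \<and> \<Union>\<C> = U"

text \<open>The subfamily written $\mathcal{C}(H)$.\<close>

definition meeting :: "'u set set \<Rightarrow> 'u set \<Rightarrow> 'u set set" where
  "meeting \<C> H = {C \<in> \<C>. C \<inter> H \<noteq> {}}"

definition partial_transversal :: "'u set \<Rightarrow> 'u set set \<Rightarrow> 'u set \<Rightarrow> bool" where
  "partial_transversal U \<C> I \<longleftrightarrow>
     I \<subseteq> U \<and> (\<exists>\<phi>. inj_on \<phi> I \<and> \<phi> ` I \<subseteq> \<C> \<and> (\<forall>e\<in>I. e \<in> \<phi> e))"

definition matroid_rank :: "'u set \<Rightarrow> 'u set set \<Rightarrow> 'u set \<Rightarrow> nat" where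
  "matroid_rank U \<C> X = Max {card I |I. I \<subseteq> X \<and> partial_transversal U \<C> I}"

definition matroid_closure :: "'u set \<Rightarrow> 'u set set \<Rightarrow> 'u set \<Rightarrow> 'u set" where
  "matroid_closure U \<C> X =
     {e \<in> U. matroid_rank U \<C> (insert e X) = matroid_rank U \<C> X}"

text \<open>The lattice $L(\mathcal{C})$, ordered by inclusion.\<close>

definition flats :: "'u set \<Rightarrow> 'u set set \<Rightarrow> 'u set set" where
  "flats U \<C> = {F. F \<subseteq> U \<and> matroid_closure U \<C> F = F}"

text \<open>The set $L^{(\ell)}(\mathcal{C})$.\<close>

definition flats_of_height :: "'u set \<Rightarrow> 'u set set \<Rightarrow> nat \<Rightarrow> 'u set set" where
  "flats_of_height U \<C> l = {F \<in> flats U \<C>. height (flats U \<C>) F = l}"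

text \<open>\<open>E_set U \<C> x\<close> is $E(\{x\})$, and \<open>E_family U \<C>\<close> is $\mathcal{E}$. The latter is a set of
  sets: elements \<open>x\<close> with equal $E(\{x\})$ contribute one member.\<close>

definition E_set :: "'u set \<Rightarrow> 'u set set \<Rightarrow> 'u \<Rightarrow> 'u set" where
  "E_set U \<C> x = {y \<in> U. meeting \<C> {y} \<subseteq> meeting \<C> {x}}"

definition E_family :: "'u set \<Rightarrow> 'u set set \<Rightarrow> 'u set set" where
  "E_family U \<C> = {E_set U \<C> x |x. x \<in> U \<and> card (meeting \<C> {x}) = 2}"

end

(* Under the hypothesis on singly covered points the matroid is simple, so its flats of height 0
   and 1 are the empty set and the points. Three points are dependent exactly when they lie in a
   common E(x), and k = 1 leaves only one such set E. The bound on the flats of height 2 forces E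
   to have at least three points. A point off E has m - 1 covers, whereas a point of E has
   1 + (m - |E|), so uniformity gives E = U. Hence the lattice has a bottom, q + 1 atoms and a top,
   like the lattice of subspaces of a plane over the field with q elements. *)

theory Submission imports Defs begin

section \<open>Lattices of length two\<close>

text \<open>The shape shared by both lattices: bottom, top and an antichain of atoms strictly
  between. \<open>A\<close> may be empty, so the two-element chain needed for dimension one is
  included.\<close>

definition three_levels :: "'a::order set \<Rightarrow> 'a \<Rightarrow> 'a set \<Rightarrow> 'a \<Rightarrow> bool" where
  "three_levels L b A t \<longleftrightarrow> L = insert b (insert t A) \<and> b < t \<and>
     (\<forall>a\<in>A. b < a \<and> a < t) \<and> (\<forall>a\<in>A. \<forall>a'\<in>A. a \<le> a' \<longrightarrow> a = a')"

text \<open>The middle elements are pairwise incomparable and all lie between the two ends, so the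
  order carries no information beyond the size of the middle level.\<close>

lemma order_isomorphic_three_levels:
  assumes L: "three_levels L b A t" and L': "three_levels L' b' A' t'" and g: "bij_betw g A A'"
  shows "order_isomorphic L L'"
proof -
  define f where "f x = (if x = b then b' else if x = t then t' else g x)" for x
  have [simp]: "f b = b'" "f t = t'"
    using L by (auto simp: f_def three_levels_def)
  have fA: "f a = g a" "g a \<in> A'" if "a \<in> A" for a
    using L that bij_betwE[OF g] by (auto simp: f_def three_levels_def)
  have inj: "a = a'" if "a \<in> A" "a' \<in> A" "g a \<le> g a'" for a a'
    using that L' bij_betwE[OF g] bij_betw_imp_inj_on[OF g]
    unfolding three_levels_def by (meson inj_onD)
  have emb: "x \<le> y \<longleftrightarrow> f x \<le> f y" if "x \<in> L" "y \<in> L" for x y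
  proof -
    have x: "x = b \<or> x = t \<or> x \<in> A" and y: "y = b \<or> y = t \<or> y \<in> A"
      using that L by (auto simp: three_levels_def)
    have bt: "b < t" "b' < t'"
      using L L' by (auto simp: three_levels_def)
    have A: "b < a" "a < t" "b' < f a" "f a < t'" if "a \<in> A" for a
      using that L L' fA by (auto simp: three_levels_def)
    have AA: "a \<le> a' \<longleftrightarrow> f a \<le> f a'" if "a \<in> A" "a' \<in> A" for a a'
      using that inj L fA unfolding three_levels_def by (metis order_refl)
    show ?thesis
      using x
    proof (elim disjE)
      assume "x = b"
      then show ?thesis using y bt A[of y] by (auto simp: less_imp_le)
    next
      assume "x = t"
      then show ?thesis using y bt A[of y] by (auto simp: less_le_not_le)
    next
      assume "x \<in> A"
      then show ?thesis using y A[of x] AA[of x y] by (auto simp: less_le_not_le)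
    qed
  qed
  \<comment> \<open>An order embedding is injective by antisymmetry.\<close>
  have "inj_on f L"
    by (intro inj_onI order_antisym) (simp_all add: emb)
  moreover have "f ` L = L'"
  proof -
    have "f ` A = A'"
      using fA(1) bij_betw_imp_surj_on[OF g] by (simp cong: image_cong)
    then show ?thesis
      using L L' by (simp add: three_levels_def)
  qed
  ultimately show ?thesis
    unfolding order_isomorphic_def bij_betw_def using emb by blast
qed

section \<open>Subspaces of lines and planes\<close>

context finite_dimensional_vector_space
begin

lemma dim_one_eq_span:
  assumes S: "subspace S" "dim S = 1" and x: "x \<in> S" "x \<noteq> 0"
  shows "S = span {x}"
proof -
  have "span {x} = S"
    using S x by (intro subspace_dim_equal) (use span_minimal[of "{x}" S] in auto)
  then show ?thesis by simp
qed

text \<open>Sort the subspaces by dimension. A subspace contained in one of equal dimension equals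
  it, which makes the lines an antichain.\<close>

lemma subspaces_dim_two:
  assumes "dim (UNIV :: 'b set) = 2"
  shows "three_levels {S. subspace S} {0} {S. subspace S \<and> dim S = 1} UNIV"
proof -
  have dim0: "S = {0}" if "subspace S" "dim S = 0" for S
    using that subspace_0[of S] by auto
  have full: "S = UNIV" if "subspace S" "dim S = 2" for S
    using that assms subspace_dim_equal[of S UNIV] by simp
  have le: "dim S \<le> 2" for S
    using assms dim_subset_UNIV by (simp add: dimension_def)
  have "dim S = 0 \<or> dim S = 1 \<or> dim S = 2" for S
    using le[of S] by linarith
  then have "{S. subspace S} = insert {0} (insert UNIV {S. subspace S \<and> dim S = 1})"
    using dim0 full subspace_UNIV subspace_single_0 by blast
  moreover have "{0} < S \<and> S < UNIV" if "subspace S" "dim S = 1" for S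
    using that subspace_0[OF that(1)] assms dim_eq_0[of S] by (auto simp del: dim_UNIV dim_eq_0)
  moreover have "S = T" if "subspace S" "dim S = 1" "subspace T" "dim T = 1" "S \<le> T" for S T
    using that subspace_dim_equal by simp
  moreover have "{0} < (UNIV :: 'b set)"
    using assms dim_eq_0[of UNIV] by (auto simp del: dim_UNIV)
  ultimately show ?thesis
    unfolding three_levels_def by blast
qed

lemma subspaces_dim_one:
  assumes "dim (UNIV :: 'b set) = 1"
  shows "three_levels {S. subspace S} {0} {} UNIV"
proof -
  have "S = {0} \<or> S = UNIV" if "subspace S" for S
  proof -
    have "dim S \<le> 1"
      using assms dim_subset_UNIV by (simp add: dimension_def)
    then consider "dim S = 0" | "dim S = 1" by linarith
    then show ?thesis
      using that assms subspace_0[of S] subspace_dim_equal[of S UNIV] by cases auto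
  qed
  moreover have "{0} < (UNIV :: 'b set)"
    using assms dim_eq_0[of UNIV] by (auto simp del: dim_UNIV)
  ultimately show ?thesis
    unfolding three_levels_def by auto
qed

text \<open>The lines through the origin form the projective line: one for each slope in the field
  and one at infinity, which \<open>None\<close> stands for. Over a field with q elements this gives
  q + 1 lines.\<close>

lemma card_lines_of_plane:
  assumes "dim (UNIV :: 'b set) = 2"
  shows "\<exists>g. bij_betw g (UNIV :: 'a option set) {S. subspace S \<and> dim S = 1}"
proof -
  obtain D where D: "independent D" "UNIV \<subseteq> span D" "card D = 2"
    using basis_exists[of UNIV] assms by metis
  then obtain a b where ab: "D = {a, b}" "a \<noteq> b"
    by (meson card_2_iff)
  have coord: "\<exists>s t. x = s *s a + t *s b" for x
  proof -
    have "x \<in> span {a, b}" using D ab by auto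
    then show ?thesis
      by (auto simp: span_insert span_singleton algebra_simps)
  qed
  have a: "a \<notin> span {b}"
    using D ab independent_insert[of a "{b}"] by simp
  have b0: "b \<noteq> 0"
    using D ab dependent_zero by blast
  have indep: "s = 0 \<and> t = 0" if "s *s a + t *s b = 0" for s t
  proof -
    have "s = 0"
    proof (rule ccontr)
      assume s: "s \<noteq> 0"
      have "s *s a = (- t) *s b"
        using that by (simp add: eq_neg_iff_add_eq_0)
      then have "inverse s *s (s *s a) = inverse s *s ((- t) *s b)"
        by simp
      then have "a = (inverse s * (- t)) *s b"
        using s by (simp only: scale_scale) simp
      then show False
        using a by (metis rangeI span_singleton)
    qed
    then show ?thesis using that b0 by simp
  qed
  \<comment> \<open>One spanning vector per line, with basis \<open>a\<close>, \<open>b\<close>: the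
    \<open>a\<close>-coordinate is normalised to 1, and \<open>b\<close> spans the line at
    infinity.\<close>
  define v where "v z = (case z of None \<Rightarrow> b | Some t \<Rightarrow> a + t *s b)" for z
  have v0: "v z \<noteq> 0" for z
    using b0 indep[of 1] by (auto simp: v_def split: option.splits)
  have line: "span {v z} \<in> {S. subspace S \<and> dim S = 1}" for z
    using v0 by simp
  have inj: "z = z'" if eq: "span {v z} = span {v z'}" for z z'
  proof -
    have "v z \<in> span {v z'}"
      using eq span_base[of "v z" "{v z}"] by simp
    then obtain c where c: "v z = c *s v z'"
      by (auto simp: span_singleton)
    show ?thesis
    proof (cases z; cases z')
      fix t assume "z = None" "z' = Some t"
      then have "c *s a + (c * t - 1) *s b = 0"
        using c by (simp add: v_def algebra_simps)
      then have "c = 0" using indep by blast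
      then show ?thesis using c v0[of z] by simp
    next
      fix t assume "z = Some t" "z' = None"
      then have "1 *s a + (t - c) *s b = 0"
        using c by (simp add: v_def algebra_simps)
      from indep[OF this] show ?thesis by simp
    next
      fix s t assume z: "z = Some s" "z' = Some t"
      then have "(1 - c) *s a + (s - c * t) *s b = 0"
        using c by (simp add: v_def algebra_simps)
      then have "1 - c = 0 \<and> s - c * t = 0" using indep by blast
      then show ?thesis using z by simp
    qed auto
  qed
  have surj: "\<exists>z. S = span {v z}" if S: "subspace S" "dim S = 1" for S
  proof -
    have "\<not> S \<subseteq> {0}" using S(2) dim_eq_0[of S] by linarith
    then obtain x where x: "x \<in> S" "x \<noteq> 0" by auto
    obtain s t where st: "x = s *s a + t *s b" using coord by blast
    \<comment> \<open>Dividing \<open>x\<close> by its first nonzero coordinate gives the normalised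
      spanning vector; if \<open>s = 0\<close>, then \<open>t\<close> is nonzero because
      \<open>x\<close> is.\<close>
    define z where "z = (if s = 0 then None else Some (t / s))"
    have "v z = inverse (if s = 0 then t else s) *s x"
      using st x by (auto simp: z_def v_def algebra_simps divide_inverse)
    then have "v z \<in> S"
      using x S subspace_scale by metis
    then show ?thesis
      using dim_one_eq_span[OF S] v0 by blast
  qed
  have "bij_betw (\<lambda>z. span {v z}) UNIV {S. subspace S \<and> dim S = 1}"
    unfolding bij_betw_def
  proof
    show "inj (\<lambda>z. span {v z})" using inj by (rule injI)
    show "range (\<lambda>z. span {v z}) = {S. subspace S \<and> dim S = 1}"
      using line surj by blast
  qed
  then show ?thesis by blast
qed

end

section \<open>Height\<close>

text \<open>Members of a chain of subsets of \<open>S\<close> are told apart by their cardinalities,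
  which range over 0 to \<open>card S\<close>; so no chain is longer than the given
  \<open>K\<close>.\<close>

lemma height_eqI:
  assumes S: "finite S"
    and K: "K \<subseteq> {F \<in> L. F \<subseteq> S}" "Complete_Partial_Order.chain (\<subseteq>) K" "card K = Suc (card S)"
  shows "height L S = card S"
proof -
  let ?X = "{card K - 1 |K. K \<noteq> {} \<and> K \<subseteq> {F \<in> L. F \<subseteq> S} \<and> Complete_Partial_Order.chain (\<subseteq>) K}"
  have bound: "card K' - 1 \<le> card S"
    if K': "K' \<subseteq> {F \<in> L. F \<subseteq> S}" and chain: "Complete_Partial_Order.chain (\<subseteq>) K'" for K'
  proof -
    have sub: "F \<subseteq> S" if "F \<in> K'" for F
      using that K' by blast
    have "inj_on card K'"
    proof (rule inj_onI)
      fix F G assume FG: "F \<in> K'" "G \<in> K'" "card F = card G"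
      then have "finite F" "finite G"
        using sub S finite_subset by blast+
      moreover have "F \<subseteq> G \<or> G \<subseteq> F"
        using chain FG by (blast dest: Complete_Partial_Order.chainD)
      ultimately show "F = G"
        using FG(3) by (metis card_subset_eq)
    qed
    moreover have "card ` K' \<subseteq> {..card S}"
      using sub card_mono[OF S] by blast
    ultimately have "card K' \<le> card {..card S}"
      by (metis card_inj_on_le finite_atMost)
    then show ?thesis by simp
  qed
  have "\<forall>n\<in>?X. n \<le> card S"
    using bound by blast
  moreover have "card S \<in> ?X"
  proof -
    have "card S = card K - 1" "K \<noteq> {}"
      using K(3) by auto
    then show ?thesis using K(1,2) by blast
  qed
  ultimately have "Max ?X = card S"
    by (intro Max_eqI) (blast intro: iffD2[OF finite_nat_set_iff_bounded_le])+
  then show ?thesis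
    by (simp add: height_def)
qed

section \<open>Transversal matroids\<close>

lemma partial_transversal_empty: "partial_transversal U \<C> {}"
  by (simp add: partial_transversal_def)

text \<open>The block \<open>D\<close> contains no element of \<open>I\<close>, so every matching of
  \<open>I\<close> leaves it free for \<open>e\<close>.\<close>

lemma partial_transversal_insert:
  assumes I: "partial_transversal U \<C> I" and e: "e \<in> U"
    and D: "D \<in> meeting \<C> {e}" "\<And>i. i \<in> I \<Longrightarrow> D \<notin> meeting \<C> {i}"
  shows "partial_transversal U \<C> (insert e I)"
proof -
  obtain \<phi> where \<phi>: "inj_on \<phi> I" "\<phi> ` I \<subseteq> \<C>" "\<forall>i\<in>I. i \<in> \<phi> i"
    using I by (auto simp: partial_transversal_def)
  have "e \<notin> I" using D by blast
  moreover have "D \<notin> \<phi> ` I"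
    using D(2) \<phi> by (fastforce simp: meeting_def)
  ultimately have "inj_on (\<phi>(e := D)) (insert e I)"
    using \<phi>(1) by (auto simp: inj_on_def)
  then show ?thesis
    using I e D(1) \<phi> unfolding partial_transversal_def
    by (intro conjI exI[of _ "\<phi>(e := D)"]) (auto simp: meeting_def)
qed

text \<open>A matching of \<open>I\<close> occupies at most \<open>card I\<close> blocks, so one of
  the blocks containing \<open>e\<close> is still free.\<close>

lemma partial_transversal_insert_card:
  assumes I: "partial_transversal U \<C> I" "finite I" and e: "e \<in> U"
    and less: "card I < card (meeting \<C> {e})"
  shows "partial_transversal U \<C> (insert e I)"
proof (cases "e \<in> I")
  case True
  then show ?thesis using I by (simp add: insert_absorb)
next
  case False
  obtain \<phi> where \<phi>: "inj_on \<phi> I" "\<phi> ` I \<subseteq> \<C>" "\<forall>i\<in>I. i \<in> \<phi> i"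
    using I by (auto simp: partial_transversal_def)
  have "\<not> meeting \<C> {e} \<subseteq> \<phi> ` I"
    using less card_image_le[OF I(2), of \<phi>] card_mono[of "\<phi> ` I" "meeting \<C> {e}"] I(2)
    by force
  then obtain D where D: "D \<in> meeting \<C> {e}" "D \<notin> \<phi> ` I" by blast
  then have "inj_on (\<phi>(e := D)) (insert e I)"
    using \<phi>(1) False by (auto simp: inj_on_def)
  then show ?thesis
    using I e D(1) \<phi> False unfolding partial_transversal_def
    by (intro conjI exI[of _ "\<phi>(e := D)"]) (auto simp: meeting_def)
qed

lemma card_partial_transversal_le:
  assumes I: "partial_transversal U \<C> I" and M: "finite M" "\<And>i. i \<in> I \<Longrightarrow> meeting \<C> {i} \<subseteq> M"
  shows "card I \<le> card M"
proof -
  obtain \<phi> where \<phi>: "inj_on \<phi> I" "\<phi> ` I \<subseteq> \<C>" "\<forall>i\<in>I. i \<in> \<phi> i"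
    using I by (auto simp: partial_transversal_def)
  then have "\<phi> ` I \<subseteq> M"
    using M(2) by (fastforce simp: meeting_def)
  then show ?thesis
    using \<phi>(1) M(1) card_inj_on_le by blast
qed

section \<open>Rank and flats of a transversal matroid\<close>

context
  fixes U :: "'u set" and \<C> :: "'u set set"
  assumes U: "finite U"
begin

lemma finite_transversal_cards:
  "finite {card I |I. I \<subseteq> X \<and> partial_transversal U \<C> I}"
proof (rule finite_subset)
  show "{card I |I. I \<subseteq> X \<and> partial_transversal U \<C> I} \<subseteq> card ` Pow U"
    by (auto simp: partial_transversal_def)
qed (use U in simp)

lemma card_le_matroid_rank:
  assumes "partial_transversal U \<C> I" "I \<subseteq> X"
  shows "card I \<le> matroid_rank U \<C> X"
  unfolding matroid_rank_def using assms finite_transversal_cards by (intro Max_ge) auto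

lemma matroid_rank_witness:
  obtains I where "I \<subseteq> X" "partial_transversal U \<C> I" "card I = matroid_rank U \<C> X"
proof -
  have "{card I |I. I \<subseteq> X \<and> partial_transversal U \<C> I} \<noteq> {}"
    using partial_transversal_empty by blast
  from Max_in[OF finite_transversal_cards this] show ?thesis
    using that unfolding matroid_rank_def by auto
qed

text \<open>Allows flats to be recognised without computing ranks: \<open>r\<close> bounds the rank
  of \<open>F\<close> from above, and every outside point lifts the rank beyond
  \<open>r\<close>.\<close>

lemma flatI:
  assumes F: "F \<subseteq> U" and bound: "\<And>I. I \<subseteq> F \<Longrightarrow> partial_transversal U \<C> I \<Longrightarrow> card I \<le> r"
    and ext: "\<And>e. e \<in> U \<Longrightarrow> e \<notin> F \<Longrightarrow>
      \<exists>I. I \<subseteq> insert e F \<and> partial_transversal U \<C> I \<and> r < card I"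
  shows "F \<in> flats U \<C>"
proof -
  have "matroid_rank U \<C> F \<le> r"
    by (metis bound matroid_rank_witness)
  then have "matroid_rank U \<C> (insert e F) \<noteq> matroid_rank U \<C> F" if "e \<in> U" "e \<notin> F" for e
    using ext[OF that] card_le_matroid_rank by (metis leD le_trans)
  then have "matroid_closure U \<C> F = F"
    using F by (auto simp: matroid_closure_def insert_absorb)
  then show ?thesis
    using F by (simp add: flats_def)
qed

text \<open>Closedness only says that the two ranks differ; monotonicity of the rank turns this into
  a strict increase.\<close>

lemma flat_insert_witness:
  assumes F: "F \<in> flats U \<C>" and e: "e \<in> U" "e \<notin> F"
  obtains I where "I \<subseteq> insert e F" "partial_transversal U \<C> I" "matroid_rank U \<C> F < card I"
proof -
  have "e \<notin> matroid_closure U \<C> F"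
    using F e by (simp add: flats_def)
  then have ne: "matroid_rank U \<C> (insert e F) \<noteq> matroid_rank U \<C> F"
    using e by (simp add: matroid_closure_def)
  obtain J where J: "J \<subseteq> F" "partial_transversal U \<C> J" "card J = matroid_rank U \<C> F"
    by (rule matroid_rank_witness)
  then have "matroid_rank U \<C> F \<le> matroid_rank U \<C> (insert e F)"
    using card_le_matroid_rank[of J "insert e F"] by auto
  moreover obtain I where "I \<subseteq> insert e F" "partial_transversal U \<C> I"
      "card I = matroid_rank U \<C> (insert e F)"
    by (rule matroid_rank_witness)
  ultimately show ?thesis
    using that ne by simp
qed

lemma whole_flat: "U \<in> flats U \<C>"
  using U by (intro flatI[where r = "card U"]) (auto simp: card_mono)

end

section \<open>Simple transversal matroids\<close>

text \<open>Being covered, no point is a loop. Two distinct points are parallel only if both lie in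
  one and the same single block, which \<open>simple\<close> excludes.\<close>

locale simple_covering =
  fixes U :: "'u set" and \<C> :: "'u set set"
  assumes covering: "covering U \<C>"
    and simple: "\<lbrakk>u \<in> U; v \<in> U; meeting \<C> {u} = meeting \<C> {v}; card (meeting \<C> {u}) = 1\<rbrakk> \<Longrightarrow> u = v"
begin

abbreviation "indep \<equiv> partial_transversal U \<C>"
abbreviation "mt u \<equiv> meeting \<C> {u}"

lemma finite_U: "finite U"
  using covering by (simp add: covering_def)

lemma finite_mt: "finite (mt u)"
proof -
  have "finite \<C>"
    using covering finite_U unfolding covering_def by (meson finite_Pow_iff finite_subset)
  then show ?thesis by (simp add: meeting_def)
qed

lemma mt_nonempty: "u \<in> U \<Longrightarrow> mt u \<noteq> {}"
  using covering by (auto simp: covering_def meeting_def)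

lemma mt_ge_1: "u \<in> U \<Longrightarrow> 1 \<le> card (mt u)"
  using mt_nonempty finite_mt by (simp add: Suc_le_eq card_gt_0_iff)

section \<open>Independence of points and pairs\<close>

lemma indep_singleton:
  assumes "u \<in> U" shows "indep {u}"
  using partial_transversal_insert_card[OF partial_transversal_empty _ assms, of \<C>] mt_ge_1[OF assms]
  by simp

text \<open>A point in two or more blocks always finds a block not taken by the other point. Two
  distinct singly covered points have different blocks by \<open>simple\<close>.\<close>

lemma indep_pair:
  assumes "u \<in> U" "v \<in> U" shows "indep {u, v}"
proof -
  consider "card (mt u) = 1" "card (mt v) = 1" | "1 < card (mt u)" | "1 < card (mt v)"
    using mt_ge_1 assms by (metis le_neq_implies_less)
  then show ?thesis
  proof cases
    case 1
    show ?thesis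
    proof (cases "u = v")
      case False
      then have "mt u \<noteq> mt v" using simple assms 1 by blast
      then obtain D where "D \<in> mt u" "D \<notin> mt v"
        using 1 by (metis card_1_singletonE singletonI singletonD)
      then show ?thesis
        using indep_singleton assms by (intro partial_transversal_insert[of U \<C> "{v}" u D]) auto
    qed (use indep_singleton assms in simp)
  next
    case 2
    then show ?thesis
      using indep_singleton assms by (intro partial_transversal_insert_card[of U \<C> "{v}" u]) auto
  next
    case 3
    then have "indep {v, u}"
      using indep_singleton assms by (intro partial_transversal_insert_card[of U \<C> "{u}" v]) auto
    then show ?thesis by (simp add: insert_commute)
  qed
qed

section \<open>Flats with at most two points, and their heights\<close>

lemma empty_flat: "{} \<in> flats U \<C>"
proof (rule flatI[OF finite_U, where r = 0])
  show "\<exists>I\<subseteq>{e}. indep I \<and> 0 < card I" if "e \<in> U" for e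
    using that indep_singleton by (intro exI[of _ "{e}"]) simp
qed auto

lemma singleton_flat:
  assumes "u \<in> U" shows "{u} \<in> flats U \<C>"
proof (rule flatI[OF finite_U, where r = 1])
  show "card I \<le> 1" if "I \<subseteq> {u}" for I
    using card_mono[OF _ that] by simp
  show "\<exists>I\<subseteq>insert e {u}. indep I \<and> 1 < card I" if "e \<in> U" "e \<notin> {u}" for e
    using that assms indep_pair by (intro exI[of _ "{e, u}"]) auto
qed (use assms in simp)

lemma height_singleton:
  assumes "u \<in> U" shows "height (flats U \<C>) {u} = 1"
proof -
  have "height (flats U \<C>) {u} = card {u}"
  proof (rule height_eqI)
    show "{{}, {u}} \<subseteq> {F \<in> flats U \<C>. F \<subseteq> {u}}"
      by (simp add: empty_flat singleton_flat[OF assms])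
    show "Complete_Partial_Order.chain (\<subseteq>) {{}, {u}}"
      by (rule chainI) blast
  qed simp_all
  then show ?thesis by simp
qed

lemma height_pair:
  assumes uv: "u \<in> U" "v \<in> U" "u \<noteq> v" and flat: "{u, v} \<in> flats U \<C>"
  shows "height (flats U \<C>) {u, v} = 2"
proof -
  have "height (flats U \<C>) {u, v} = card {u, v}"
  proof (rule height_eqI)
    show "{{}, {u}, {u, v}} \<subseteq> {F \<in> flats U \<C>. F \<subseteq> {u, v}}"
      by (simp add: empty_flat singleton_flat[OF uv(1)] flat)
    show "Complete_Partial_Order.chain (\<subseteq>) {{}, {u}, {u, v}}"
      by (rule chainI) blast
    have "{u} \<noteq> {u, v}" using uv(3) by blast
    then show "card {{}, {u}, {u, v}} = Suc (card {u, v})"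
      using uv(3) by simp
  qed simp
  then show ?thesis using uv by simp
qed

end

section \<open>Coverings with a single nontrivial line\<close>

text \<open>Records what k = 1 provides: all doubly covered points lie in the same two
  blocks.\<close>

locale one_line_covering = simple_covering U \<C>
  for U :: "'u set" and \<C> :: "'u set set" +
  fixes C1 C2 :: "'u set"
  assumes C12: "C1 \<noteq> C2"
    and double: "\<lbrakk>u \<in> U; card (mt u) = 2\<rbrakk> \<Longrightarrow> mt u = {C1, C2}"
begin

text \<open>This is E(x) for every doubly covered point x. It also contains the points covered by
  \<open>C1\<close> alone or by \<open>C2\<close> alone.\<close>

definition line :: "'u set" where
  "line = {u \<in> U. mt u \<subseteq> {C1, C2}}"

lemma line_subset: "line \<subseteq> U"
  by (auto simp: line_def)

text \<open>Doubly covered points are on the line by \<open>double\<close>, so \<open>w\<close> has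
  a single block, and that block cannot be \<open>C1\<close> or \<open>C2\<close>.\<close>

lemma outside_line:
  assumes "w \<in> U" "w \<notin> line" "card (mt w) \<le> 2"
  obtains D where "mt w = {D}" "D \<noteq> C1" "D \<noteq> C2"
proof -
  have "card (mt w) \<noteq> 2"
    using assms double by (auto simp: line_def)
  then have "card (mt w) = 1"
    using assms(1,3) mt_ge_1[of w] by linarith
  then obtain D where "mt w = {D}" by (metis card_1_singletonE)
  then show ?thesis
    using that assms by (auto simp: line_def)
qed

text \<open>A point in three or more blocks extends any independent pair. If there is none, a point
  off the line is singly covered, and among the three points some such point has a block avoiding
  the other two.\<close>

lemma indep_triple:
  assumes in_U: "u \<in> U" "v \<in> U" "w \<in> U" and distinct: "u \<noteq> v" "u \<noteq> w" "v \<noteq> w"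
    and w: "w \<notin> line"
  shows "indep {u, v, w}"
proof -
  have big: "indep {x, y, z}"
    if "x \<in> U" "y \<in> U" "z \<in> U" "2 < card (mt x)" for x y z
  proof -
    have "card {y, z} < card (mt x)"
      using that(4) card_insert_le_m1[of 2 "{z}" y] by simp
    then show ?thesis
      using that indep_pair by (intro partial_transversal_insert_card[of U \<C> "{y, z}" x]) auto
  qed
  have perm: "{v, u, w} = {u, v, w}" "{w, u, v} = {u, v, w}" by auto
  show ?thesis
  proof (cases "2 < card (mt u) \<or> 2 < card (mt v) \<or> 2 < card (mt w)")
    case True
    then show ?thesis
      using big[of u v w] big[of v u w] big[of w u v] in_U perm by metis
  next
    case False
    then obtain D where D: "mt w = {D}" "D \<noteq> C1" "D \<noteq> C2"
      using outside_line[of w] in_U w by (metis not_le)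
    \<comment> \<open>The block of \<open>x\<close> is private: \<open>simple\<close> keeps it from
      being the block of another singly covered point, and points of the line lie only in
      \<open>C1\<close> and \<open>C2\<close>.\<close>
    have other: "indep {x, y, w}"
      if xy: "x \<in> U" "y \<in> U" "x \<noteq> w" "y \<noteq> w" "x \<noteq> y" "x \<notin> line" "card (mt x) \<le> 2" "card (mt y) \<le> 2" for x y
    proof -
      obtain D' where D': "mt x = {D'}" "D' \<noteq> C1" "D' \<noteq> C2"
        using outside_line xy by metis
      have "D' \<noteq> D"
        using simple[of x w] xy in_U D D' by auto
      moreover have "D' \<notin> mt y"
      proof (cases "y \<in> line")
        case True
        then show ?thesis using D' by (auto simp: line_def)
      next
        case False
        then obtain D'' where D'': "mt y = {D''}"
          using outside_line xy by metis
        then have "D'' \<noteq> D'"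
          using simple[of x y] xy D' by auto
        then show ?thesis using D'' by simp
      qed
      ultimately show ?thesis
        using indep_pair[of y w] xy in_U D D' by (intro partial_transversal_insert[of U \<C> "{y, w}" x D']) auto
    qed
    consider "u \<notin> line" | "v \<notin> line" | "u \<in> line" "v \<in> line" by blast
    then show ?thesis
    proof cases
      case 1
      then show ?thesis using other[of u v] False in_U distinct by simp
    next
      case 2
      then show ?thesis using other[of v u] False in_U distinct perm by simp
    next
      \<comment> \<open>Here \<open>u\<close> and \<open>v\<close> lie only in \<open>C1\<close> and
        \<open>C2\<close>, so the block \<open>D\<close> of \<open>w\<close> is free.\<close>
      case 3
      then have "indep (insert w {u, v})"
        using D in_U indep_pair by (intro partial_transversal_insert[of U \<C> "{u, v}" w D]) (auto simp: line_def)
      then show ?thesis using perm by simp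
    qed
  qed
qed

text \<open>The condition \<open>sub\<close> rules out a third point collinear with \<open>u\<close>
  and \<open>v\<close>. Hence adding any point gives a triple not inside the line, which is
  independent.\<close>

lemma pair_flat:
  assumes uv: "u \<in> U" "v \<in> U" "u \<noteq> v"
    and sub: "{u, v} \<subseteq> line \<Longrightarrow> line \<subseteq> {u, v}"
  shows "{u, v} \<in> flats U \<C>"
proof (rule flatI[OF finite_U, where r = 2])
  show "card I \<le> 2" if "I \<subseteq> {u, v}" for I
    using card_mono[OF _ that] uv by simp
  show "\<exists>I\<subseteq>insert e {u, v}. indep I \<and> 2 < card I" if e: "e \<in> U" "e \<notin> {u, v}" for e
  proof -
    have "\<not> {u, v, e} \<subseteq> line"
      using sub e by blast
    \<comment> \<open>Any of the three points may be the one off the line; it is put last each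
      time.\<close>
    then have "indep {u, v, e} \<or> indep {u, e, v} \<or> indep {e, v, u}"
      using indep_triple[of u v e] indep_triple[of u e v] indep_triple[of e v u] uv e by auto
    moreover have "{u, e, v} = {u, v, e}" "{e, v, u} = {u, v, e}" by auto
    ultimately have "indep {u, v, e}" by metis
    then show ?thesis
      using uv e by (intro exI[of _ "{u, v, e}"]) auto
  qed
qed (use uv in simp)

text \<open>Points of the line can be matched only to \<open>C1\<close> and
  \<open>C2\<close>.\<close>

lemma card_indep_line:
  assumes "indep I" "I \<subseteq> line" shows "card I \<le> 2"
proof -
  have "card I \<le> card {C1, C2}"
    using assms by (intro card_partial_transversal_le) (auto simp: line_def)
  then show ?thesis using C12 by simp
qed

lemma line_flat:
  assumes uv: "u \<in> line" "v \<in> line" "u \<noteq> v"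
  shows "line \<in> flats U \<C>"
proof (rule flatI[OF finite_U line_subset, where r = 2])
  show "\<exists>I\<subseteq>insert e line. indep I \<and> 2 < card I" if e: "e \<in> U" "e \<notin> line" for e
  proof -
    have ne: "u \<noteq> e" "v \<noteq> e" using uv e by auto
    then have "indep {u, v, e}"
      using indep_triple[of u v e] uv e line_subset by auto
    then show ?thesis
      using uv ne by (intro exI[of _ "{u, v, e}"]) auto
  qed
qed (use card_indep_line in auto)

text \<open>A maximal independent set of \<open>insert w F\<close> could be exchanged into one inside \<open>F\<close>, because
  \<open>u\<close> and \<open>v\<close> together can be matched to \<open>C1\<close> and \<open>C2\<close>.\<close>

lemma line_subset_flat:
  assumes F: "F \<in> flats U \<C>" and uv: "u \<in> line" "v \<in> line" "u \<noteq> v" "u \<in> F" "v \<in> F"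
  shows "line \<subseteq> F"
proof (rule ccontr)
  assume "\<not> line \<subseteq> F"
  then obtain w where w: "w \<in> line" "w \<notin> F" by blast
  then have wU: "w \<in> U" using line_subset by blast
  obtain I where I: "I \<subseteq> insert w F" "indep I" "matroid_rank U \<C> F < card I"
    using flat_insert_witness[OF finite_U F wU w(2)] by blast
  have fin: "finite I"
    using I(2) finite_U by (auto simp: partial_transversal_def intro: finite_subset)
  \<comment> \<open>The contradiction aimed at: \<open>I\<close> is larger than the rank of
    \<open>F\<close>, so no independent subset of \<open>F\<close> can have its size.\<close>
  have no: "card J \<noteq> card I" if "J \<subseteq> F" "indep J" for J
    using card_le_matroid_rank[OF finite_U that(2,1)] I(3) by linarith
  have wI: "w \<in> I"
    using I no[of I] by blast
  obtain \<phi> where \<phi>: "inj_on \<phi> I" "\<phi> ` I \<subseteq> \<C>" "\<forall>i\<in>I. i \<in> \<phi> i"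
    using I(2) by (auto simp: partial_transversal_def)
  have \<phi>_line: "\<phi> i \<in> {C1, C2}" if "i \<in> I \<inter> line" for i
    using that \<phi> by (fastforce simp: line_def meeting_def)
  obtain \<psi> where \<psi>: "inj_on \<psi> {u, v}" "\<psi> ` {u, v} \<subseteq> \<C>" "\<forall>i\<in>{u, v}. i \<in> \<psi> i"
    using indep_pair[of u v] uv line_subset by (auto simp: partial_transversal_def)
  have "\<psi> i \<in> {C1, C2}" if "i \<in> {u, v}" for i
    using that \<psi> uv by (fastforce simp: line_def meeting_def)
  then have \<psi>_image: "\<psi> ` {u, v} = {C1, C2}"
    using \<psi>(1) C12 uv(3)
    by (intro card_subset_eq) (auto simp: card_image)
  show False
  proof (cases "I \<inter> line = {w}")
    \<comment> \<open>Only \<open>w\<close> has to be replaced. Whichever of \<open>u\<close> and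
      \<open>v\<close> is sent by \<open>\<psi>\<close> to the block of \<open>w\<close> takes over
      that block.\<close>
    case True
    obtain x where x: "x \<in> {u, v}" "\<psi> x = \<phi> w"
      using \<phi>_line[of w] \<psi>_image True by (metis imageE insertI1)
    have xI: "x \<notin> I" using x True uv w by auto
    define \<theta> where "\<theta> = \<phi>(x := \<phi> w)"
    have \<theta>: "inj_on \<theta> (insert x (I - {w}))" "\<theta> ` insert x (I - {w}) \<subseteq> \<C>"
        "\<forall>i\<in>insert x (I - {w}). i \<in> \<theta> i"
      using \<phi> xI wI \<psi>(3) x by (auto simp: \<theta>_def inj_on_def)
    have "indep (insert x (I - {w}))"
    proof -
      have "insert x (I - {w}) \<subseteq> U"
        using I(2) x uv line_subset by (auto simp: partial_transversal_def)
      then show ?thesis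
        unfolding partial_transversal_def using \<theta> by (intro conjI exI[of _ \<theta>]) simp_all
    qed
    moreover have "insert x (I - {w}) \<subseteq> F"
      using I(1) x uv by auto
    moreover have "card (insert x (I - {w})) = card I"
      using card_insert_disjoint[of "I - {w}" x] card_Suc_Diff1[OF fin wI] xI fin by simp
    ultimately show False using no by blast
  next
    case False
    then obtain w' where w': "w' \<in> I" "w' \<in> line" "w' \<noteq> w"
      using wI w by blast
    \<comment> \<open>Now \<open>I\<close> has exactly two points on the line, and they use up
      \<open>C1\<close> and \<open>C2\<close>. The rest of \<open>I\<close> is therefore matched to
      other blocks.\<close>
    have "indep (I \<inter> line)"
      using I(2) unfolding partial_transversal_def by (meson inf_le1 inj_on_subset image_mono subset_trans subsetD)
    then have "card (I \<inter> line) \<le> 2"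
      using card_indep_line by blast
    moreover have "{w, w'} \<subseteq> I \<inter> line" "card {w, w'} = 2"
      using w w' wI by auto
    ultimately have J: "I \<inter> line = {w, w'}"
      using fin by (metis card_seteq finite_Int)
    have \<phi>_image: "\<phi> ` {w, w'} = {C1, C2}"
      using \<phi>_line[of w] \<phi>_line[of w'] \<phi>(1) w w' wI C12
      by (auto dest: inj_onD)
    have free: "\<phi> i \<notin> {C1, C2}" if "i \<in> I - line" for i
    proof (rule notI)
      assume "\<phi> i \<in> {C1, C2}"
      then obtain j where "j \<in> {w, w'}" "\<phi> i = \<phi> j"
        using \<phi>_image by (metis imageE)
      then have "i = j"
        using \<phi>(1) that w' wI by (auto dest: inj_onD)
      then show False
        using \<open>j \<in> {w, w'}\<close> that w w' by blast
    qed
    \<comment> \<open>The pair \<open>w\<close>, \<open>w'\<close> is exchanged for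
      \<open>u\<close>, \<open>v\<close>, matched by \<open>\<psi>\<close> to the same two blocks,
      and the rest of \<open>I\<close> keeps its matching. The point \<open>w'\<close> may itself be
      \<open>u\<close> or \<open>v\<close>.\<close>
    define \<theta> where "\<theta> i = (if i \<in> {u, v} then \<psi> i else \<phi> i)" for i
    define I' where "I' = {u, v} \<union> (I - line)"
    have "inj_on \<theta> I'"
    proof -
      have uv_part: "\<theta> ` {u, v} = {C1, C2}" "inj_on \<theta> {u, v}"
        using \<psi>_image \<psi>(1) by (auto simp: \<theta>_def inj_on_def)
      have eq: "\<theta> i = \<phi> i" if "i \<in> I - line" for i
        using that uv by (auto simp: \<theta>_def)
      then have rest: "inj_on \<theta> (I - line)"
        using \<phi>(1) by (auto simp: inj_on_def)
      have "\<theta> i \<notin> {C1, C2}" if "i \<in> I - line" for i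
        using eq[OF that] free[OF that] by simp
      then have "\<theta> ` {u, v} \<inter> \<theta> ` (I - line) = {}"
        using uv_part(1) by auto
      moreover have "{u, v} - (I - line) = {u, v}" "(I - line) - {u, v} = I - line"
        using uv by auto
      ultimately show ?thesis
        unfolding I'_def inj_on_Un using uv_part(2) rest by simp
    qed
    moreover have "\<theta> ` I' \<subseteq> \<C>" "\<forall>i\<in>I'. i \<in> \<theta> i"
      using \<phi>(2,3) \<psi>(2,3) by (auto simp: \<theta>_def I'_def)
    moreover have "I' \<subseteq> U"
      using I(2) uv line_subset by (auto simp: I'_def partial_transversal_def)
    ultimately have "indep I'"
      unfolding partial_transversal_def by blast
    moreover have "I' \<subseteq> F"
      using I(1) w uv by (auto simp: I'_def)
    moreover have "card I' = card I"
    proof -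
      have "card I' = 2 + card (I - line)"
        unfolding I'_def using uv fin by (subst card_Un_disjoint) auto
      moreover have "card I = card (I \<inter> line) + card (I - line)"
        using fin by (metis card_Int_Diff)
      ultimately show ?thesis
        using J w' by simp
    qed
    ultimately show False using no by blast
  qed
qed

text \<open>One inequality at each of two points suffices: \<open>p\<close> off the line has at
  least \<open>card U - 1\<close> covers, \<open>a\<close> on it at most
  \<open>1 + (card U - card line)\<close>. These numbers cannot agree once the line has three
  points.\<close>

lemma line_eq_U:
  assumes uniform: "uniform_lattice (flats U \<C>)" and card: "3 \<le> card line"
  shows "line = U"
proof (rule ccontr)
  assume "line \<noteq> U"
  then obtain p where p: "p \<in> U" "p \<notin> line" using line_subset by blast
  have fin: "finite line" using line_subset finite_U finite_subset by blast
  have "\<not> card line \<le> Suc 0" using card by simp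
  then obtain a b where ab: "a \<in> line" "b \<in> line" "a \<noteq> b"
    by (metis card_le_Suc0_iff_eq fin)
  have aU: "a \<in> U" using ab line_subset by blast
  let ?L = "flats U \<C>"
  have pair: "{x, y} \<in> ?L" if "x \<in> U" "y \<in> U" "x \<noteq> y" "x \<notin> line \<or> y \<notin> line" for x y
    using that by (intro pair_flat) auto
  \<comment> \<open>The flat \<open>{x, y}\<close> lies strictly above \<open>{x}\<close> and below
    \<open>z\<close>, so the cover \<open>z\<close> must equal it.\<close>
  have covers: "z = {x, y}"
    if "covered_by ?L {x} z" "y \<in> z" "x \<noteq> y" "{x, y} \<in> ?L" for x y z
    using that unfolding covered_by_def by (metis (no_types, lifting) empty_subsetI insert_subset psubsetI
      singletonD insertCI psubset_imp_subset)
  have "inj_on (\<lambda>y. {p, y}) (U - {p})"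
    by (auto simp: inj_on_def doubleton_eq_iff)
  then have "card U - 1 = card ((\<lambda>y. {p, y}) ` (U - {p}))"
    using p finite_U by (simp add: card_image)
  also have "\<dots> \<le> card {z. covered_by ?L {p} z}"
  proof (rule card_mono)
    have "finite ?L"
      using finite_U by (auto simp: flats_def intro: finite_subset[of _ "Pow U"])
    then show "finite {z. covered_by ?L {p} z}"
      by (rule finite_subset[rotated]) (auto simp: covered_by_def)
    have "covered_by ?L {p} {p, y}" if "y \<in> U" "y \<noteq> p" for y
      using that p pair[of p y] singleton_flat unfolding covered_by_def by auto
    then show "(\<lambda>y. {p, y}) ` (U - {p}) \<subseteq> {z. covered_by ?L {p} z}"
      by auto
  qed
  \<comment> \<open>Uniformity applies because both singletons have height 1.\<close>
  also have "\<dots> = card {z. covered_by ?L {a} z}"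
    using uniform p aU singleton_flat height_singleton unfolding uniform_lattice_def by metis
  also have "\<dots> \<le> card (insert line ((\<lambda>y. {a, y}) ` (U - line)))"
  proof (rule card_mono)
    show "finite (insert line ((\<lambda>y. {a, y}) ` (U - line)))"
      using finite_U by simp
    show "{z. covered_by ?L {a} z} \<subseteq> insert line ((\<lambda>y. {a, y}) ` (U - line))"
    proof
      fix z assume "z \<in> {z. covered_by ?L {a} z}"
      then have z: "covered_by ?L {a} z" by simp
      then have zL: "z \<in> ?L" "a \<in> z" "z \<noteq> {a}" "z \<subseteq> U"
        by (auto simp: covered_by_def flats_def)
      then obtain y where y: "y \<in> z" "y \<noteq> a" "y \<in> U" by blast
      show "z \<in> insert line ((\<lambda>y. {a, y}) ` (U - line))"
      proof (cases "y \<in> line")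
        case True
        \<comment> \<open>A cover of \<open>{a}\<close> with a second point on the line contains the
          whole line, which is itself a flat strictly above \<open>{a}\<close>.\<close>
        then have "line \<subseteq> z"
          using line_subset_flat zL y ab by metis
        moreover have "{a} \<subset> line" using ab by auto
        ultimately have "z = line"
          using z line_flat[OF ab] unfolding covered_by_def by (metis psubsetI)
        then show ?thesis by simp
      next
        case False
        then have "z = {a, y}"
          using covers[OF z y(1)] y pair[of a y] aU by auto
        then show ?thesis using False y by simp
      qed
    qed
  qed
  also have "\<dots> \<le> Suc (card (U - line))"
    using card_image_le[of "U - line" "\<lambda>y. {a, y}"] finite_U by (simp add: card_insert_if)
  also have "\<dots> = Suc (card U - card line)"
    using line_subset fin by (simp add: card_Diff_subset)
  finally show False
    using card card_mono[OF finite_U line_subset] by linarith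
qed

text \<open>By \<open>line_subset_flat\<close>, a flat with two points is already \<open>U\<close>.
  The bound on \<open>card U\<close> keeps the singletons strictly below \<open>U\<close>.\<close>

lemma flats_of_line:
  assumes eq: "line = U" and card: "2 \<le> card U"
  shows "three_levels (flats U \<C>) {} ((\<lambda>u. {u}) ` U) U"
proof -
  have "F = {} \<or> F = U \<or> (\<exists>u\<in>U. F = {u})" if F: "F \<in> flats U \<C>" for F
  proof (rule ccontr)
    assume neg: "\<not> ?thesis"
    have FU: "F \<subseteq> U" using F by (simp add: flats_def)
    obtain u where u: "u \<in> F" using neg by blast
    then obtain v where v: "v \<in> F" "v \<noteq> u" using neg FU by blast
    then show False
      using line_subset_flat[OF F, of u v] eq neg FU u by auto
  qed
  then have "flats U \<C> = insert {} (insert U ((\<lambda>u. {u}) ` U))"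
    using empty_flat whole_flat[OF finite_U] singleton_flat by blast
  moreover have "{u} \<noteq> U" "U \<noteq> {}" for u
    using card by auto
  ultimately show ?thesis
    unfolding three_levels_def by auto
qed

text \<open>If the line had at most two points, every pair would be a flat of height 2, and there
  would be too many of them.\<close>

lemma three_le_card_line:
  assumes "card (flats_of_height U \<C> 2) < card U choose 2"
  shows "3 \<le> card line"
proof (rule ccontr)
  assume small: "\<not> 3 \<le> card line"
  have fin: "finite line" using line_subset finite_U finite_subset by blast
  have "{P. P \<subseteq> U \<and> card P = 2} \<subseteq> flats_of_height U \<C> 2"
  proof
    fix P assume "P \<in> {P. P \<subseteq> U \<and> card P = 2}"
    then obtain u v where P: "P = {u, v}" "u \<noteq> v" "u \<in> U" "v \<in> U"
      by (auto simp: card_2_iff)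
    have "line \<subseteq> {u, v}" if "{u, v} \<subseteq> line"
      using card_seteq[OF fin that] small P by simp
    then have "{u, v} \<in> flats U \<C>"
      using P by (intro pair_flat) auto
    then show "P \<in> flats_of_height U \<C> 2"
      using height_pair P by (simp add: flats_of_height_def)
  qed
  moreover have "flats_of_height U \<C> 2 \<subseteq> Pow U"
    by (auto simp: flats_of_height_def flats_def)
  then have "finite (flats_of_height U \<C> 2)"
    using finite_U by (simp add: finite_subset)
  ultimately have "card {P. P \<subseteq> U \<and> card P = 2} \<le> card (flats_of_height U \<C> 2)"
    by (rule card_mono[rotated])
  then show False using assms n_subsets[OF finite_U, of 2] by simp
qed

end

text \<open>Equality of E(u) and E(x) puts u into E(x), so the blocks of u are among those of x.
  Both have two blocks, so these coincide.\<close>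

lemma (in simple_covering) one_line_coveringI:
  assumes "card (E_family U \<C>) = 1"
  shows "\<exists>C1 C2. one_line_covering U \<C> C1 C2"
proof -
  obtain E where E: "E_family U \<C> = {E}"
    using assms by (metis card_1_singletonE)
  then have "E \<in> E_family U \<C>" by simp
  then obtain x where x: "x \<in> U" "card (mt x) = 2" "E = E_set U \<C> x"
    by (auto simp: E_family_def)
  obtain C1 C2 where C: "mt x = {C1, C2}" "C1 \<noteq> C2"
    using x(2) by (meson card_2_iff)
  have "mt u = {C1, C2}" if u: "u \<in> U" "card (mt u) = 2" for u
  proof -
    have "E_set U \<C> u = E_set U \<C> x"
      using E u x unfolding E_family_def by blast
    then have "mt u \<subseteq> mt x"
      using u by (auto simp: E_set_def)
    then show ?thesis
      using C u x finite_mt by (metis card_subset_eq)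
  qed
  then have "one_line_covering U \<C> C1 C2"
    using C by unfold_locales auto
  then show ?thesis by blast
qed

theorem theorem4p14:
  fixes scale :: "'k::{field,finite} \<Rightarrow> 'v::ab_group_add \<Rightarrow> 'v"
    and B :: "'v set" and n q :: nat
  assumes "finite_dimensional_vector_space scale B"
    and "vector_space.dim scale (UNIV :: 'v set) = n"
    and "CARD('k) = q"
  shows "(n = 0 \<or> n = 1 \<longrightarrow>
           (\<exists>(U :: nat set) \<C>. covering U \<C> \<and>
              order_isomorphic (flats U \<C>) {S. module.subspace scale S})) \<and>
         (\<forall>(U :: 'u set) \<C> m k.
            covering U \<C> \<and> card U = m \<and>
            \<not> (\<exists>u\<in>U. \<exists>v\<in>U. u \<noteq> v \<and> meeting \<C> {u} = meeting \<C> {v} \<and>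
                 card (meeting \<C> {u}) = 1) \<and>
            uniform_lattice (flats U \<C>) \<and>
            card (flats_of_height U \<C> 2) < m choose 2 \<and>
            k = card (E_family U \<C>) \<and>
            n = 2 \<and> m = q + 1 \<and> k = 1 \<longrightarrow>
            order_isomorphic (flats U \<C>) {S. module.subspace scale S})"
proof (intro conjI impI allI)
  interpret V: finite_dimensional_vector_space scale B by fact
  show "\<exists>(U :: nat set) \<C>. covering U \<C> \<and> order_isomorphic (flats U \<C>) {S. V.subspace S}"
    if n: "n = 0 \<or> n = 1"
    using n
  proof
    assume "n = 0"
    then have "V.dim (UNIV :: 'v set) = 0" using assms(2) by simp
    then have "(UNIV :: 'v set) = {0}" using V.dim_eq_0[of UNIV] by auto
    then have "S = {0}" if "V.subspace S" for S
      using V.subspace_0[OF that] by (metis UNIV_I singleton_iff subsetI subset_antisym empty_subsetI insert_subset)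
    then have "{S. V.subspace S} = {{0}}"
      using V.subspace_single_0 by blast
    \<comment> \<open>The empty family covers the empty set and has a single flat, matching the one
      subspace of the zero space.\<close>
    moreover have "flats ({} :: nat set) {} = {{}}"
      by (auto simp: flats_def matroid_closure_def)
    ultimately have "order_isomorphic (flats ({} :: nat set) {}) {S. V.subspace S}"
      by (auto simp: order_isomorphic_def bij_betw_def intro: exI[of _ "\<lambda>_. {0}"])
    moreover have "covering ({} :: nat set) {}"
      by (simp add: covering_def)
    ultimately show ?thesis by blast
  next
    assume "n = 1"
    then have sub: "three_levels {S. V.subspace S} {0} {} UNIV"
      using V.subspaces_dim_one assms(2) by simp
    \<comment> \<open>One point covered by one block: its two flats form a chain, like the two
      subspaces of a one-dimensional space.\<close>
    interpret simple_covering "{0 :: nat}" "{{0}}"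
      by unfold_locales (auto simp: covering_def)
    have "flats {0 :: nat} {{0}} = {{}, {0}}"
      using empty_flat whole_flat[OF finite_U] by (auto simp: flats_def)
    then have "three_levels (flats {0 :: nat} {{0}}) {} {} {0}"
      by (auto simp: three_levels_def)
    then have "order_isomorphic (flats {0 :: nat} {{0}}) {S. V.subspace S}"
      using sub by (rule order_isomorphic_three_levels) (simp add: bij_betw_def)
    then show ?thesis using covering by blast
  qed
  fix U :: "'u set" and \<C> m k
  assume "covering U \<C> \<and> card U = m \<and>
            \<not> (\<exists>u\<in>U. \<exists>v\<in>U. u \<noteq> v \<and> meeting \<C> {u} = meeting \<C> {v} \<and>
                 card (meeting \<C> {u}) = 1) \<and>
            uniform_lattice (flats U \<C>) \<and>
            card (flats_of_height U \<C> 2) < m choose 2 \<and>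
            k = card (E_family U \<C>) \<and>
            n = 2 \<and> m = q + 1 \<and> k = 1"
  then have cov: "covering U \<C>" and m: "card U = m" "m = q + 1" and n: "n = 2"
    and simple: "\<not> (\<exists>u\<in>U. \<exists>v\<in>U. u \<noteq> v \<and> meeting \<C> {u} = meeting \<C> {v} \<and> card (meeting \<C> {u}) = 1)"
    and uniform: "uniform_lattice (flats U \<C>)"
    and less: "card (flats_of_height U \<C> 2) < card U choose 2"
    and k: "card (E_family U \<C>) = 1"
    by auto
  have "simple_covering U \<C>"
    using cov simple by unfold_locales auto
  then obtain C1 C2 where "one_line_covering U \<C> C1 C2"
    using simple_covering.one_line_coveringI k by blast
  then interpret one_line_covering U \<C> C1 C2 .
  have line: "line = U"
    using line_eq_U uniform three_le_card_line less by blast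
  have flats: "three_levels (flats U \<C>) {} ((\<lambda>u. {u}) ` U) U"
    using flats_of_line line three_le_card_line[OF less] by simp
  have dim: "V.dim (UNIV :: 'v set) = 2" using assms(2) n by simp
  obtain g where g: "bij_betw g (UNIV :: 'k option set) {S. V.subspace S \<and> V.dim S = 1}"
    using V.card_lines_of_plane[OF dim] by blast
  \<comment> \<open>There are m = q + 1 atoms on one side and q slopes plus the line at infinity on
    the other, so the atoms can be matched with the lines.\<close>
  have "card ((\<lambda>u. {u}) ` U) = CARD('k option)"
    using m assms(3) by (simp add: card_image card_UNIV_option)
  then obtain h where "bij_betw h ((\<lambda>u. {u}) ` U) (UNIV :: 'k option set)"
    using finite_same_card_bij[of "(\<lambda>u. {u}) ` U" "UNIV :: 'k option set"] finite_U by auto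
  then have "bij_betw (g \<circ> h) ((\<lambda>u. {u}) ` U) {S. V.subspace S \<and> V.dim S = 1}"
    using g bij_betw_trans by blast
  then show "order_isomorphic (flats U \<C>) {S. V.subspace S}"
    using order_isomorphic_three_levels[OF flats V.subspaces_dim_two[OF dim]] by blast
qed

end
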